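(* Let $G$ be a claw-free $n$-vertex graph. Then $f_{re}(G)\leq n-1$; that is, $E(G)$ can be partitioned into at most $n-1$ sets, each of which is the edge set of a $2$-regular subgraph of $G$ or consists of a single edge.
   Context: Graphs are finite and simple, with at least one vertex. A graph is claw-free if it has no induced subgraph isomorphic to $K_{1,3}$. A $2$-regular subgraph of $G$ is a subgraph in which every vertex has degree exactly $2$; it need be neither connected nor spanning. A decomposition of $G=(V,E)$ into $2$-regular subgraphs and edges is a partition $E_1,\dots,E_k$ of $E$ such that each subgraph $H_i=(V(E_i),E_i)$ is $2$-regular or a single edge, where $V(E_i)$ is the set of vertices incident to edges in $E_i$ (the empty partition, $k=0$, is used if $E=\emptyset$). $f_{re}(G)$ denotes the minimum number $k$ of subgraphs in a decomposition of $G$ into $2$-regular subgraphs and edges. *)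

theory Defs
  imports Main "HOL-Library.Disjoint_Sets"
begin

text \<open>A graph is a pair of a vertex set and an edge set, edges being 2-element sets of vertices.\<close>

type_synonym 'a ugraph = "'a set \<times> 'a set set"

abbreviation verts :: "'a ugraph \<Rightarrow> 'a set" where
  "verts G \<equiv> fst G"

abbreviation edges :: "'a ugraph \<Rightarrow> 'a set set" where
  "edges G \<equiv> snd G"

definition simple_graph :: "'a ugraph \<Rightarrow> bool" where
  "simple_graph G \<longleftrightarrow>
     finite (verts G) \<and> verts G \<noteq> {} \<and> (\<forall>e\<in>edges G. e \<subseteq> verts G \<and> card e = 2)"

definition subgraph :: "'a ugraph \<Rightarrow> 'a ugraph \<Rightarrow> bool" where
  "subgraph H G \<longleftrightarrow> simple_graph H \<and> verts H \<subseteq> verts G \<and> edges H \<subseteq> edges G"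

definition induced_subgraph :: "'a ugraph \<Rightarrow> 'a set \<Rightarrow> 'a ugraph" where
  "induced_subgraph G W = (W, {e \<in> edges G. e \<subseteq> W})"

definition isomorphic :: "'a ugraph \<Rightarrow> 'b ugraph \<Rightarrow> bool" where
  "isomorphic G H \<longleftrightarrow>
     (\<exists>f. bij_betw f (verts G) (verts H) \<and>
        (\<forall>u\<in>verts G. \<forall>v\<in>verts G. {u, v} \<in> edges G \<longleftrightarrow> {f u, f v} \<in> edges H))"

definition claw :: "nat ugraph" where
  "claw = ({0, 1, 2, 3}, {{0, 1}, {0, 2}, {0, 3}})"

definition claw_free :: "'a ugraph \<Rightarrow> bool" where
  "claw_free G \<longleftrightarrow> \<not> (\<exists>W. W \<subseteq> verts G \<and> isomorphic (induced_subgraph G W) claw)"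

definition degree :: "'a ugraph \<Rightarrow> 'a \<Rightarrow> nat" where
  "degree G v = card {e \<in> edges G. v \<in> e}"

definition two_regular :: "'a ugraph \<Rightarrow> bool" where
  "two_regular G \<longleftrightarrow> (\<forall>v\<in>verts G. degree G v = 2)"

definition edge_subgraph :: "'a set set \<Rightarrow> 'a ugraph" where
  "edge_subgraph F = (\<Union>F, F)"

text \<open>The parts of a \<^const>\<open>partition_on\<close> are nonempty, and the only partition of the
  empty set is the empty one.\<close>

definition re_decomposition :: "'a ugraph \<Rightarrow> 'a set set set \<Rightarrow> bool" where
  "re_decomposition G P \<longleftrightarrow>
     partition_on (edges G) P \<and>
     (\<forall>F\<in>P. two_regular (edge_subgraph F) \<or> (\<exists>e. F = {e}))"

definition f_re :: "'a ugraph \<Rightarrow> nat" where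
  "f_re G = (LEAST k. \<exists>P. re_decomposition G P \<and> card P = k)"

text \<open>The minimum is attained by a finite decomposition, so \<^const>\<open>f_re\<close> is meaningful
  on every simple graph.\<close>

lemma finite_edges: "simple_graph G \<Longrightarrow> finite (edges G)"
  unfolding simple_graph_def by (rule finite_subset[of _ "Pow (verts G)"]) auto

lemma finite_re_decomposition:
  "simple_graph G \<Longrightarrow> re_decomposition G P \<Longrightarrow> finite P"
  unfolding re_decomposition_def using finite_edges finite_elements by blast

lemma re_decomposition_singletons: "re_decomposition G ((\<lambda>e. {e}) ` edges G)"
  unfolding re_decomposition_def partition_on_def disjoint_def by auto

lemma f_re_attained: "\<exists>P. re_decomposition G P \<and> card P = f_re G"
  unfolding f_re_def by (rule LeastI_ex) (use re_decomposition_singletons in blast)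

end

(*
Let F be a smallest set of edges with the same odd-degree vertices as G, so that E - F is even.

An even graph of maximum degree 2d decomposes into d two-regular subgraphs (Petersen): give it an
orientation with equal in- and outdegrees, add loops to make it d-regular and use Hall's theorem to
split off permutations of the vertices; the non-fixed points of each permutation form disjoint cycles.

It remains to see that |F| + d <= n - 1, where v has degree 2d in E - F. By minimality, an even
set of edges has at most half of its edges in F. Hence F is a forest, a component of F spans no
further edge of G, and claw-freeness makes every component a path. For the same reason, of the 2d
neighbours of v along E - F none lies in the component of v, and those lying in one component are
pairwise at distance at most 2 there, so there are at most three of them, and three only as
consecutive vertices. Three neighbours in each of two components would give, by claw-freeness at v,
a 6-cycle with four edges in F. So F has at least d + 1 components, i.e. at most n - d - 1 edges.
*)

theory Submission
  imports Defs
begin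

subsection \<open>Degree parity and components of forests\<close>

text \<open>This is the boundary of \<open>Q\<close> modulo 2. It is additive under symmetric
  difference of finite sets, so paths and cycles can be treated by parity computations instead of
  vertex sequences.\<close>

definition odd_verts :: "'a set set \<Rightarrow> 'a set" where
  "odd_verts Q = {v. odd (card {e \<in> Q. v \<in> e})}"

lemma odd_verts_empty [simp]: "odd_verts {} = {}"
  by (simp add: odd_verts_def)

lemma odd_card_sym_diff:
  assumes "finite A" "finite B"
  shows "odd (card (sym_diff A B)) \<longleftrightarrow> odd (card A) \<noteq> odd (card B)"
proof -
  have "card (sym_diff A B) = card (A - B) + card (B - A)"
    using assms by (intro card_Un_disjoint) auto
  moreover have "card A = card (A - B) + card (A \<inter> B)"
    using assms by (subst card_Un_disjoint [symmetric]) (auto intro: arg_cong [where f = card])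
  moreover have "card B = card (B - A) + card (A \<inter> B)"
    using assms by (subst card_Un_disjoint [symmetric]) (auto intro: arg_cong [where f = card])
  ultimately show ?thesis by presburger
qed

lemma odd_verts_sym_diff:
  assumes "finite A" "finite B"
  shows "odd_verts (sym_diff A B) = sym_diff (odd_verts A) (odd_verts B)"
proof (rule set_eqI)
  fix v
  have "{e \<in> sym_diff A B. v \<in> e} = sym_diff {e \<in> A. v \<in> e} {e \<in> B. v \<in> e}" by auto
  then show "v \<in> odd_verts (sym_diff A B) \<longleftrightarrow> v \<in> sym_diff (odd_verts A) (odd_verts B)"
    using odd_card_sym_diff [of "{e \<in> A. v \<in> e}" "{e \<in> B. v \<in> e}"] assms
    by (auto simp: odd_verts_def)
qed

lemma odd_verts_singleton [simp]: "odd_verts {e} = e"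
proof -
  have "{d \<in> {e}. v \<in> d} = (if v \<in> e then {e} else {})" for v by auto
  then show ?thesis by (auto simp: odd_verts_def split: if_splits)
qed

lemma odd_verts_insert:
  assumes "finite Q" "e \<notin> Q"
  shows "odd_verts (insert e Q) = sym_diff e (odd_verts Q)"
proof -
  have "insert e Q = sym_diff {e} Q" using assms by auto
  then show ?thesis using odd_verts_sym_diff [of "{e}" Q] assms by simp
qed

lemma odd_verts_remove:
  assumes "finite Q" "e \<in> Q"
  shows "odd_verts (Q - {e}) = sym_diff e (odd_verts Q)"
proof -
  have "odd_verts Q = sym_diff e (odd_verts (Q - {e}))"
    using odd_verts_insert [of "Q - {e}" e] assms by (simp add: insert_absorb)
  then show ?thesis by blast
qed

lemma odd_verts_subset: "odd_verts Q \<subseteq> \<Union>Q"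
proof
  fix v assume "v \<in> odd_verts Q"
  then have "card {e \<in> Q. v \<in> e} \<noteq> 0" by (intro notI) (simp add: odd_verts_def)
  then have "{e \<in> Q. v \<in> e} \<noteq> {}" by (intro notI) simp
  then show "v \<in> \<Union>Q" by blast
qed

text \<open>By the handshake lemma this means that \<open>x\<close> and \<open>y\<close> lie in the same component of \<open>F\<close>;
  a parity condition replaces the path between them.\<close>

definition linked :: "'a set set \<Rightarrow> 'a \<Rightarrow> 'a \<Rightarrow> bool" where
  "linked F x y \<longleftrightarrow> (\<exists>Q \<subseteq> F. odd_verts Q = sym_diff {x} {y})"

lemma linked_refl: "linked F x x"
  unfolding linked_def by (rule exI [of _ "{}"]) auto

lemma linked_sym: "linked F x y \<Longrightarrow> linked F y x"
  by (simp add: linked_def Un_commute)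

text \<open>The sum modulo 2 of the two witnesses is again a witness: \<open>y\<close> cancels in
  its boundary.\<close>

lemma linked_trans:
  assumes "finite F" "linked F x y" "linked F y z"
  shows "linked F x z"
proof -
  obtain Q R where Q: "Q \<subseteq> F" "odd_verts Q = sym_diff {x} {y}"
    and R: "R \<subseteq> F" "odd_verts R = sym_diff {y} {z}"
    using assms unfolding linked_def by blast
  have "odd_verts (sym_diff Q R) = sym_diff (sym_diff {x} {y}) (sym_diff {y} {z})"
    using odd_verts_sym_diff [of Q R] Q R assms(1) by (simp add: finite_subset)
  also have "\<dots> = sym_diff {x} {z}" by blast
  finally have "odd_verts (sym_diff Q R) = sym_diff {x} {z}" .
  moreover have "sym_diff Q R \<subseteq> F" using Q R by blast
  ultimately show ?thesis unfolding linked_def by (intro exI conjI)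
qed

lemma linked_edge: "{x, y} \<in> F \<Longrightarrow> x \<noteq> y \<Longrightarrow> linked F x y"
  unfolding linked_def by (rule exI [of _ "{{x, y}}"]) auto

lemma linked_mono: "linked F x y \<Longrightarrow> F \<subseteq> G \<Longrightarrow> linked G x y"
  unfolding linked_def by blast

lemma other_endpoint:
  assumes "card e = 2" "s \<in> e"
  obtains u where "e = {s, u}" "u \<noteq> s"
proof -
  have "card (e - {s}) = 1" using assms by simp
  then obtain u where "e - {s} = {u}" using card_1_singletonE by blast
  then have "e = {s, u}" "u \<noteq> s" using assms by auto
  then show ?thesis by (rule that)
qed

text \<open>A walk from \<open>s\<close> must reach another odd vertex. After deleting its first
  edge \<open>{s, u}\<close>, either \<open>u\<close> was odd in \<open>Q\<close>, or it has become
  odd and the induction continues from \<open>u\<close>.\<close>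

lemma odd_verts_linked_pair:
  assumes "finite Q" "\<And>e. e \<in> Q \<Longrightarrow> card e = 2" "s \<in> odd_verts Q"
  shows "\<exists>t. t \<noteq> s \<and> t \<in> odd_verts Q \<and> linked Q s t"
  using assms
proof (induction "card Q" arbitrary: Q s)
  case 0
  then show ?case by simp
next
  case (Suc n)
  obtain e where e: "e \<in> Q" "s \<in> e" using Suc.prems(3) odd_verts_subset [of Q] by blast
  obtain u where u: "e = {s, u}" "u \<noteq> s"
    using other_endpoint [OF Suc.prems(2) [OF e(1)] e(2)] .
  have rem: "odd_verts (Q - {e}) = sym_diff e (odd_verts Q)"
    using odd_verts_remove [OF Suc.prems(1) e(1)] .
  show ?case
  proof (cases "u \<in> odd_verts Q")
    case True
    then show ?thesis using linked_edge [of s u Q] e u by blast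
  next
    case False
    then have "u \<in> odd_verts (Q - {e})" using rem u by blast
    moreover have "n = card (Q - {e})" using Suc.hyps(2) e by simp
    ultimately obtain t where t: "t \<noteq> u" "t \<in> odd_verts (Q - {e})" "linked (Q - {e}) u t"
      using Suc.hyps(1) [of "Q - {e}" u] Suc.prems by auto
    have "linked Q s t"
      using linked_trans [of Q s u t] linked_edge [of s u Q] linked_mono [OF t(3)] e u Suc.prems(1)
      by auto
    \<comment> \<open>Deleting \<open>e\<close> changes parities only at \<open>s\<close> and
      \<open>u\<close>, and \<open>s\<close> becomes even. So \<open>t\<close> is neither of them
      and was odd before.\<close>
    moreover have "t \<noteq> s" "t \<in> odd_verts Q" using t rem u Suc.prems(3) by auto
    ultimately show ?thesis by blast
  qed
qed

text \<open>Subsets \<open>Q\<close> of a forest \<open>F\<close> and subsets \<open>S\<close> of a set \<open>R\<close> of vertices in distinct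
  components are determined by the symmetric difference of \<open>odd_verts Q\<close> and \<open>S\<close>.\<close>

lemma card_forest_le:
  assumes "finite V" "F \<subseteq> Pow V" "\<And>e. e \<in> F \<Longrightarrow> card e = 2"
    and forest: "\<And>Q. Q \<subseteq> F \<Longrightarrow> odd_verts Q = {} \<Longrightarrow> Q = {}"
    and R: "R \<subseteq> V" "\<And>x y. x \<in> R \<Longrightarrow> y \<in> R \<Longrightarrow> linked F x y \<Longrightarrow> x = y"
  shows "card F + card R \<le> card V"
proof -
  have fin: "finite F" "finite R"
    using assms(1,2) R(1) by (auto intro: finite_subset)
  define f :: "'a set set \<times> 'a set \<Rightarrow> 'a set" where "f = (\<lambda>(Q, S). sym_diff (odd_verts Q) S)"
  have "inj_on f (Pow F \<times> Pow R)"
  proof (rule inj_onI, clarify)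
    fix Q S Q' S'
    assume QS: "Q \<subseteq> F" "S \<subseteq> R" "Q' \<subseteq> F" "S' \<subseteq> R" and "f (Q, S) = f (Q', S')"
    then have eq: "sym_diff (odd_verts Q) S = sym_diff (odd_verts Q') S'" by (simp add: f_def)
    have fQ: "finite Q" "finite Q'" using QS fin finite_subset by blast+
    let ?D = "sym_diff Q Q'"
    have D: "odd_verts ?D = sym_diff S S'"
      unfolding odd_verts_sym_diff [OF fQ] using eq by blast
    \<comment> \<open>All odd vertices of \<open>?D\<close> lie in \<open>R\<close>, so two of them
      in the same component of \<open>F\<close> contradict the choice of \<open>R\<close>.\<close>
    have "odd_verts ?D = {}"
    proof (rule ccontr)
      assume "odd_verts ?D \<noteq> {}"
      then obtain s where s: "s \<in> odd_verts ?D" by blast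
      then obtain t where "t \<noteq> s" "t \<in> odd_verts ?D" "linked ?D s t"
        using odd_verts_linked_pair [of ?D s] fQ QS assms(3) by blast
      moreover have "linked F s t" using linked_mono [OF \<open>linked ?D s t\<close>] QS by blast
      ultimately show False using R(2) [of s t] s D QS by blast
    qed
    moreover from this have "?D = {}" using forest QS by (metis Diff_subset Un_least order_trans)
    ultimately show "Q = Q' \<and> S = S'" using D by blast
  qed
  moreover have "f ` (Pow F \<times> Pow R) \<subseteq> Pow V"
    using R(1) assms(2) odd_verts_subset unfolding f_def by fastforce
  ultimately have "card (Pow F \<times> Pow R) \<le> card (Pow V)"
    using assms(1) by (intro card_inj_on_le [of f]) auto
  then have "(2::nat) ^ (card F + card R) \<le> 2 ^ card V"
    by (simp add: card_cartesian_product card_Pow fin assms(1) power_add)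
  then show ?thesis by simp
qed

subsection \<open>Hall's theorem\<close>

definition hall_condition :: "'i set \<Rightarrow> ('i \<Rightarrow> 'b set) \<Rightarrow> bool" where
  "hall_condition I A \<longleftrightarrow> (\<forall>J\<subseteq>I. card J \<le> card (\<Union>(A ` J)))"

text \<open>Rado's argument: if deleting \<open>x\<close> and deleting \<open>y\<close> from the same set \<open>A i\<close> both violate Hall's
  condition, then submodularity of \<open>J \<mapsto> card (\<Union>(A ` J))\<close> gives a contradiction.\<close>

lemma hall_condition_shrink:
  assumes "finite I" "\<And>i. i \<in> I \<Longrightarrow> finite (A i)" "hall_condition I A"
    and i: "i \<in> I" "x \<in> A i" "y \<in> A i" "x \<noteq> y"
  shows "hall_condition I (A(i := A i - {x})) \<or> hall_condition I (A(i := A i - {y}))"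
proof (rule ccontr)
  \<comment> \<open>A violating index set contains \<open>i\<close>, since no other set has changed.
    Leaving out \<open>i\<close> turns the strict inequality into a weak one.\<close>
  have viol: "\<exists>J. J \<subseteq> I - {i} \<and> card (\<Union>(A ` J) \<union> (A i - {z})) \<le> card J"
    if not_hall: "\<not> hall_condition I (A(i := A i - {z}))" for z
  proof -
    obtain K where K: "K \<subseteq> I" "card (\<Union>((A(i := A i - {z})) ` K)) < card K"
      using not_hall unfolding hall_condition_def by (auto simp: not_le)
    have "i \<in> K"
    proof (rule ccontr)
      assume "i \<notin> K"
      then have "(A(i := A i - {z})) ` K = A ` K" by auto
      then show False using K assms(3) unfolding hall_condition_def by (metis not_le)
    qed
    then have eq: "\<Union>((A(i := A i - {z})) ` K) = \<Union>(A ` (K - {i})) \<union> (A i - {z})"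
      by (auto split: if_splits)
    moreover have "card (K - {i}) = card K - 1" using \<open>i \<in> K\<close> by simp
    ultimately have "card (\<Union>(A ` (K - {i})) \<union> (A i - {z})) \<le> card (K - {i})"
      using K(2) unfolding eq by linarith
    moreover have "K - {i} \<subseteq> I - {i}" using K(1) by blast
    ultimately show ?thesis by (intro exI conjI)
  qed
  assume "\<not> ?thesis"
  then have not_hall: "\<not> hall_condition I (A(i := A i - {x}))" "\<not> hall_condition I (A(i := A i - {y}))"
    by simp_all
  obtain J where J: "J \<subseteq> I - {i}" "card (\<Union>(A ` J) \<union> (A i - {x})) \<le> card J"
    using viol [OF not_hall(1)] by auto
  obtain K where K: "K \<subseteq> I - {i}" "card (\<Union>(A ` K) \<union> (A i - {y})) \<le> card K"
    using viol [OF not_hall(2)] by auto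
  let ?X = "\<Union>(A ` J) \<union> (A i - {x})" and ?Y = "\<Union>(A ` K) \<union> (A i - {y})"
  have finJK: "finite J" "finite K" using J(1) K(1) assms(1) by (auto intro: finite_subset)
  have fin: "finite ?X" "finite ?Y" using finJK J K assms(2) i(1) by auto
  \<comment> \<open>As \<open>x \<noteq> y\<close>, no element of \<open>A i\<close> is missing from
    both \<open>?X\<close> and \<open>?Y\<close>. The index \<open>i\<close> then counts once more
    than submodularity allows.\<close>
  have "\<Union>(A ` insert i (J \<union> K)) = ?X \<union> ?Y" using i by auto
  moreover have "card (insert i (J \<union> K)) \<le> card (\<Union>(A ` insert i (J \<union> K)))"
    using assms(3) J(1) K(1) i(1) unfolding hall_condition_def
    by (intro assms(3) [unfolded hall_condition_def, rule_format]) auto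
  moreover have "card (insert i (J \<union> K)) = Suc (card (J \<union> K))"
    using J K finJK by (subst card_insert_disjoint) auto
  ultimately have "Suc (card (J \<union> K)) \<le> card (?X \<union> ?Y)" by metis
  moreover have "card (J \<inter> K) \<le> card (\<Union>(A ` (J \<inter> K)))"
    using J(1) by (intro assms(3) [unfolded hall_condition_def, rule_format]) auto
  moreover have "card (\<Union>(A ` (J \<inter> K))) \<le> card (?X \<inter> ?Y)"
    using fin by (intro card_mono) auto
  moreover have "card (?X \<union> ?Y) + card (?X \<inter> ?Y) = card ?X + card ?Y"
    using card_Un_Int [OF fin] by simp
  moreover have "card (J \<union> K) + card (J \<inter> K) = card J + card K"
    using card_Un_Int [OF finJK] by simp
  ultimately show False using J(2) K(2) by linarith
qed

text \<open>Induction on the total size of the sets. As long as some set has two elements, one of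
  them can be deleted. Once all sets are singletons, Hall's condition for pairs of indices makes the
  choice injective.\<close>

theorem hall:
  assumes "finite I" "\<And>i. i \<in> I \<Longrightarrow> finite (A i)" "hall_condition I A"
  shows "\<exists>f. inj_on f I \<and> (\<forall>i\<in>I. f i \<in> A i)"
  using assms(2,3)
proof (induction "\<Sum>i\<in>I. card (A i)" arbitrary: A rule: less_induct)
  case less
  have shrink: ?case
    if i: "i \<in> I" and z: "z \<in> A i" and H: "hall_condition I (A(i := A i - {z}))" for i z
  proof -
    let ?B = "A(i := A i - {z})"
    have less_i: "card (A i - {z}) < card (A i)"
      using i z less.prems(1) by (intro card_Diff1_less) auto
    have "(\<Sum>j\<in>I. card (?B j)) < (\<Sum>j\<in>I. card (A j))"
    proof (rule sum_strict_mono_ex1 [OF assms(1)])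
      show "\<forall>j\<in>I. card (?B j) \<le> card (A j)" using less_i by simp
      show "\<exists>j\<in>I. card (?B j) < card (A j)" using less_i i by auto
    qed
    moreover have "finite (?B j)" if "j \<in> I" for j using less.prems(1) [OF that] less.prems(1) [OF i] by simp
    ultimately obtain f where f: "inj_on f I" "\<forall>j\<in>I. f j \<in> ?B j"
      using less.hyps [of ?B] H by meson
    have "f j \<in> A j" if "j \<in> I" for j
      using bspec [OF f(2) that] by (cases "j = i") auto
    then show ?thesis using f(1) by blast
  qed
  show ?case
  proof (cases "\<exists>i\<in>I. \<exists>x\<in>A i. \<exists>y\<in>A i. x \<noteq> y")
    case True
    then obtain i x y where i: "i \<in> I" "x \<in> A i" "y \<in> A i" "x \<noteq> y" by blast
    show ?thesis
      using hall_condition_shrink [OF assms(1) less.prems i]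
    proof
      assume "hall_condition I (A(i := A i - {x}))"
      then show ?thesis by (rule shrink [OF i(1,2)])
    next
      assume "hall_condition I (A(i := A i - {y}))"
      then show ?thesis by (rule shrink [OF i(1,3)])
    qed
  next
    case False
    have "A i \<noteq> {}" if "i \<in> I" for i
      using less.prems(2) that unfolding hall_condition_def by (auto dest: spec [of _ "{i}"])
    then have "\<forall>i\<in>I. \<exists>x. x \<in> A i" by (simp add: ex_in_conv)
    then obtain f where "\<forall>i\<in>I. f i \<in> A i" by (rule bchoice [THEN exE])
    then have f: "f i \<in> A i" if "i \<in> I" for i using that by blast
    have A: "A i = {f i}" if "i \<in> I" for i using f [OF that] False that by blast
    have "inj_on f I"
    proof (rule inj_onI, rule ccontr)
      fix i j assume ij: "i \<in> I" "j \<in> I" "f i = f j" "i \<noteq> j"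
      then have "card {i, j} \<le> card (\<Union>(A ` {i, j}))"
        by (intro less.prems(2) [unfolded hall_condition_def, rule_format]) auto
      then show False using ij A by simp
    qed
    then show ?thesis using f by blast
  qed
qed

subsection \<open>Even graphs\<close>

definition out_deg :: "('a \<times> 'a) set \<Rightarrow> 'a \<Rightarrow> nat" where
  "out_deg A x = card (A `` {x})"

abbreviation in_deg :: "('a \<times> 'a) set \<Rightarrow> 'a \<Rightarrow> nat" where
  "in_deg A \<equiv> out_deg (A\<inverse>)"

abbreviation unordered :: "'a \<times> 'a \<Rightarrow> 'a set" where
  "unordered \<equiv> \<lambda>(x, y). {x, y}"

text \<open>Bijectivity makes every edge receive exactly one of its two directions.\<close>

abbreviation orientation :: "('a \<times> 'a) set \<Rightarrow> 'a set set \<Rightarrow> bool" where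
  "orientation A E \<equiv> bij_betw unordered A E"

lemma out_deg_insert:
  assumes "finite A" "(p, u) \<notin> A"
  shows "out_deg (insert (p, u) A) x = out_deg A x + of_bool (x = p)"
proof -
  have "insert (p, u) A `` {x} = (if x = p then insert u (A `` {x}) else A `` {x})" by auto
  then show ?thesis using assms finite_Image [of A "{x}"] by (simp add: out_deg_def bij_betw_def)
qed

lemma in_deg_insert:
  assumes "finite A" "(p, u) \<notin> A"
  shows "in_deg (insert (p, u) A) x = in_deg A x + of_bool (x = u)"
proof -
  have "(insert (p, u) A)\<inverse> = insert (u, p) (A\<inverse>)" by auto
  then show ?thesis using out_deg_insert [of "A\<inverse>" u p x] assms by simp
qed

lemma out_deg_Diff:
  assumes "finite A" "M \<subseteq> A"
  shows "out_deg (A - M) x = out_deg A x - out_deg M x"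
proof -
  have "(A - M) `` {x} = A `` {x} - M `` {x}" by auto
  moreover have "M `` {x} \<subseteq> A `` {x}" using assms(2) by auto
  ultimately show ?thesis
    using finite_Image [OF finite_subset [OF assms(2,1)], of "{x}"]
    by (simp add: out_deg_def card_Diff_subset)
qed

text \<open>The induction follows a trail from \<open>s\<close>: orienting its first edge \<open>{s, u}\<close> away from \<open>s\<close>
  leaves the statement for \<open>u\<close> and \<open>t\<close>.\<close>

lemma trail_orientation:
  assumes "finite E" "\<And>e. e \<in> E \<Longrightarrow> card e = 2" "odd_verts E = sym_diff {s} {t}"
  shows "\<exists>A. orientation A E \<and>
    (\<forall>x. out_deg A x + of_bool (x = t) = in_deg A x + of_bool (x = s))"
  using assms
proof (induction "card E" arbitrary: E s t)
  case 0
  then have "E = {}" by simp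
  have "s = t"
  proof (rule ccontr)
    assume "s \<noteq> t"
    then have "s \<in> odd_verts E" unfolding 0(4) by simp
    then show False using \<open>E = {}\<close> by simp
  qed
  then show ?case using \<open>E = {}\<close> by (intro exI [of _ "{}"]) (simp add: out_deg_def bij_betw_def)
next
  case (Suc n)
  have step: "\<exists>A. orientation A E \<and>
      (\<forall>x. out_deg A x + of_bool (x = t) = in_deg A x + of_bool (x = p))"
    if e: "{p, u} \<in> E" "p \<noteq> u" and odd: "odd_verts E = sym_diff {p} {t}" for p u t
  proof -
    have "odd_verts (E - {{p, u}}) = sym_diff {p, u} (sym_diff {p} {t})"
      using odd_verts_remove [OF Suc.prems(1) e(1)] odd by simp
    also have "\<dots> = sym_diff {u} {t}" using e(2) by blast
    finally have "odd_verts (E - {{p, u}}) = sym_diff {u} {t}" .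
    moreover have "n = card (E - {{p, u}})" using Suc.hyps(2) e(1) by simp
    ultimately obtain A where A: "orientation A (E - {{p, u}})"
      "\<And>x. out_deg A x + of_bool (x = t) = in_deg A x + of_bool (x = u)"
      using Suc.hyps(1) [of "E - {{p, u}}" u t] Suc.prems(1,2) by (meson Diff_iff finite_Diff)
    have img: "unordered ` A = E - {{p, u}}" and inj: "inj_on unordered A"
      using A(1) by (auto simp: bij_betw_def)
    have new: "(p, u) \<notin> A"
    proof
      assume "(p, u) \<in> A"
      then have "unordered (p, u) \<in> unordered ` A" by (rule imageI)
      then show False using img by simp
    qed
    have fin: "finite A" using A(1) Suc.prems(1) by (simp add: bij_betw_finite)
    have "inj_on unordered (insert (p, u) A)"
      using inj img new by (simp add: inj_on_insert)
    moreover have "unordered ` insert (p, u) A = E" using img e(1) by auto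
    ultimately have "orientation (insert (p, u) A) E" by (simp add: bij_betw_def)
    moreover have "out_deg (insert (p, u) A) x + of_bool (x = t)
        = in_deg (insert (p, u) A) x + of_bool (x = p)" for x
      using A(2) [of x] out_deg_insert [OF fin new] in_deg_insert [OF fin new] by simp
    ultimately show ?thesis by blast
  qed
  show ?case
  proof (cases "s = t")
    case True
    \<comment> \<open>When \<open>s = t\<close> the claim does not depend on the common vertex, so a
      closed trail may start at an endpoint of any edge.\<close>
    obtain e where e: "e \<in> E" using Suc.hyps(2) by (metis card.empty ex_in_conv nat.distinct(1))
    then obtain p u where "e = {p, u}" "p \<noteq> u" using Suc.prems(2) card_2_iff by metis
    then show ?thesis using step [of p u p] True Suc.prems(3) e by simp
  next
    case False
    then have "s \<in> odd_verts E" using Suc.prems(3) by simp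
    then obtain e where e: "e \<in> E" "s \<in> e" using odd_verts_subset [of E] by blast
    obtain u where "e = {s, u}" "u \<noteq> s"
      using other_endpoint [OF Suc.prems(2) [OF e(1)] e(2)] .
    then show ?thesis using step [of s u t] Suc.prems(3) e(1) by simp
  qed
qed

section \<open>Petersen's theorem by splitting off permutations\<close>

text \<open>Adding \<open>d - out_deg A x\<close> loops at each \<open>x\<close> makes the digraph
  \<open>d\<close>-regular. Double counting its arcs gives Hall's condition for the
  out-neighbourhoods \<open>N\<close>, and an injective choice on the finite set \<open>V\<close> is
  a permutation.\<close>

lemma balanced_permutation:
  assumes "finite V" "A \<subseteq> V \<times> V"
    and bal: "\<And>x. x \<in> V \<Longrightarrow> out_deg A x = in_deg A x" "\<And>x. x \<in> V \<Longrightarrow> out_deg A x \<le> d"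
    and "0 < d"
  shows "\<exists>\<sigma>. bij_betw \<sigma> V V \<and> (\<forall>x\<in>V. (x, \<sigma> x) \<in> A \<or> (\<sigma> x = x \<and> out_deg A x < d))"
proof -
  define N where "N x = A `` {x} \<union> {y. y = x \<and> out_deg A x < d}" for x
  \<comment> \<open>The multiplicity of the arc from \<open>x\<close> to \<open>y\<close> after the
    loops have been added.\<close>
  define w where "w x y = of_bool ((x, y) \<in> A) + (if x = y then d - out_deg A x else 0)" for x y
  have row: "(\<Sum>y\<in>V. w x y) = d" if x: "x \<in> V" for x
  proof -
    have "{y \<in> V. (x, y) \<in> A} = A `` {x}" using assms(2) by auto
    then have "(\<Sum>y\<in>V. of_bool ((x, y) \<in> A)) = out_deg A x"
      using assms(1) by (simp add: out_deg_def of_bool_def sum.If_cases Int_def)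
    then show ?thesis using x assms(1) bal(2) [OF x] by (simp add: w_def sum.distrib)
  qed
  have col: "(\<Sum>x\<in>V. w x y) = d" if y: "y \<in> V" for y
  proof -
    have "{x \<in> V. (x, y) \<in> A} = A\<inverse> `` {y}" using assms(2) by auto
    then have "(\<Sum>x\<in>V. of_bool ((x, y) \<in> A)) = in_deg A y"
      using assms(1) by (simp add: out_deg_def of_bool_def sum.If_cases Int_def)
    moreover have "(\<Sum>x\<in>V. if x = y then d - out_deg A x else 0) = d - out_deg A y"
      using y assms(1) by simp
    ultimately show ?thesis using bal(1) [OF y] bal(2) [OF y] by (simp add: w_def sum.distrib)
  qed
  have N: "N x \<subseteq> V" if "x \<in> V" for x using that assms(2) by (auto simp: N_def)
  have supp: "w x y = 0" if "x \<in> V" "y \<notin> N x" for x y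
    using that bal(2) [of x] by (auto simp: w_def N_def)
  have "hall_condition V N"
    unfolding hall_condition_def
  proof (intro allI impI)
    fix J assume J: "J \<subseteq> V"
    let ?B = "\<Union>(N ` J)"
    have B: "?B \<subseteq> V" using J N by blast
    \<comment> \<open>All arcs leaving \<open>J\<close> end in \<open>?B\<close>, whose vertices
      receive \<open>d\<close> arcs each.\<close>
    have "card J * d = (\<Sum>x\<in>J. \<Sum>y\<in>V. w x y)" using row J by (simp add: subset_iff)
    also have "\<dots> = (\<Sum>x\<in>J. \<Sum>y\<in>?B. w x y)"
    proof (rule sum.cong [OF refl])
      fix x assume "x \<in> J"
      then show "(\<Sum>y\<in>V. w x y) = (\<Sum>y\<in>?B. w x y)"
        using J B assms(1) supp [of x] by (intro sum.mono_neutral_right) auto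
    qed
    also have "\<dots> = (\<Sum>y\<in>?B. \<Sum>x\<in>J. w x y)" by (rule sum.swap)
    also have "\<dots> \<le> (\<Sum>y\<in>?B. \<Sum>x\<in>V. w x y)"
      using J assms(1) by (intro sum_mono sum_mono2) auto
    also have "\<dots> = card ?B * d" using col B by (simp add: subset_iff)
    finally show "card J \<le> card ?B" using \<open>0 < d\<close> by simp
  qed
  moreover have "finite (N x)" if "x \<in> V" for x
    using N [OF that] assms(1) finite_subset by blast
  ultimately obtain \<sigma> where \<sigma>: "inj_on \<sigma> V" "\<forall>x\<in>V. \<sigma> x \<in> N x"
    using hall [OF assms(1)] by blast
  moreover have "\<sigma> ` V = V"
    using \<sigma> N by (intro endo_inj_surj [OF assms(1)]) auto
  ultimately show ?thesis by (intro exI [of _ \<sigma>]) (auto simp: bij_betw_def N_def)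
qed

text \<open>A non-fixed vertex meets two arcs of \<open>M\<close>, one to its image and one from its
  preimage. They give different edges because injectivity of \<open>unordered\<close> excludes
  cycles of length two.\<close>

lemma two_regular_permutation:
  assumes \<sigma>: "bij_betw \<sigma> V V" and M: "M = {(x, \<sigma> x) |x. x \<in> V \<and> \<sigma> x \<noteq> x}"
    and inj: "inj_on unordered M"
  shows "two_regular (edge_subgraph (unordered ` M))"
  unfolding two_regular_def edge_subgraph_def
proof
  fix v assume "v \<in> verts (\<Union>(unordered ` M), unordered ` M)"
  then obtain x where "x \<in> V" "\<sigma> x \<noteq> x" "v = x \<or> v = \<sigma> x" unfolding M by auto
  then have v: "v \<in> V" "\<sigma> v \<noteq> v"
    using \<sigma> by (auto simp: bij_betw_def inj_on_def)
  then obtain p where p: "p \<in> V" "\<sigma> p = v" "p \<noteq> v"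
    using \<sigma> unfolding bij_betw_def by (metis imageE)
  have "a = (v, \<sigma> v) \<or> a = (p, v)" if "a \<in> M" "v \<in> unordered a" for a
    using that p(1,2) \<sigma> unfolding M by (auto simp: bij_betw_def inj_on_def)
  then have "{e \<in> unordered ` M. v \<in> e} = {unordered (v, \<sigma> v), unordered (p, v)}"
    using p v by (auto simp: M image_iff)
  moreover have "unordered (v, \<sigma> v) \<noteq> unordered (p, v)"
    using inj_onD [OF inj, of "(v, \<sigma> v)" "(p, v)"] p v by (auto simp: M)
  ultimately show "degree (\<Union>(unordered ` M), unordered ` M) v = 2"
    by (simp add: degree_def)
qed

text \<open>Induction on \<open>d\<close>: the non-trivial cycles of a permutation form one part,
  and removing them keeps the digraph balanced and lowers the degree bound by one.\<close>

lemma balanced_two_regular_partition: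
  assumes "finite V" "A \<subseteq> V \<times> V" "orientation A E" "\<And>x. (x, x) \<notin> A"
    and "\<And>x. x \<in> V \<Longrightarrow> out_deg A x = in_deg A x" "\<And>x. x \<in> V \<Longrightarrow> out_deg A x \<le> d"
  shows "\<exists>P. partition_on E P \<and> finite P \<and> card P \<le> d \<and>
    (\<forall>F\<in>P. two_regular (edge_subgraph F))"
  using assms(2-)
proof (induction d arbitrary: A E)
  case 0
  have finA: "finite A" using 0(1) assms(1) finite_subset by blast
  have "A = {}"
  proof (rule ccontr)
    assume "A \<noteq> {}"
    then obtain x y where "(x, y) \<in> A" by auto
    then show False using 0(1) 0(5) [of x] finite_Image [OF finA, of "{x}"] by (auto simp: out_deg_def)
  qed
  then have "E = {}" using 0(2) by (simp add: bij_betw_def)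
  then show ?case by (intro exI [of _ "{}"]) (simp add: partition_on_def)
next
  case (Suc d)
  have finA: "finite A" using Suc.prems(1) assms(1) finite_subset by blast
  obtain \<sigma> where \<sigma>: "bij_betw \<sigma> V V"
    and A: "\<And>x. x \<in> V \<Longrightarrow> (x, \<sigma> x) \<in> A \<or> (\<sigma> x = x \<and> out_deg A x < Suc d)"
    using balanced_permutation [OF assms(1) Suc.prems(1,4,5)] by auto
  define M where "M = {(x, \<sigma> x) |x. x \<in> V \<and> \<sigma> x \<noteq> x}"
  have MA: "M \<subseteq> A" using A by (auto simp: M_def)
  have inj: "inj_on unordered A" and img: "unordered ` A = E"
    using Suc.prems(2) by (auto simp: bij_betw_def)
  have out_M: "out_deg M x = of_bool (\<sigma> x \<noteq> x)" if "x \<in> V" for x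
  proof -
    have "M `` {x} = (if \<sigma> x \<noteq> x then {\<sigma> x} else {})" using that by (auto simp: M_def)
    then show ?thesis by (simp add: out_deg_def bij_betw_def)
  qed
  have in_M: "in_deg M x = of_bool (\<sigma> x \<noteq> x)" if "x \<in> V" for x
  proof -
    have "x \<in> \<sigma> ` V" using that bij_betw_imp_surj_on [OF \<sigma>] by simp
    then obtain p where p: "p \<in> V" "x = \<sigma> p" by (rule imageE)
    have p_iff: "\<sigma> y = x \<longleftrightarrow> y = p" if "y \<in> V" for y
      using inj_on_eq_iff [OF bij_betw_imp_inj_on [OF \<sigma>] that p(1)] p(2) by simp
    have "{y \<in> V. \<sigma> y = x \<and> x \<noteq> y} = {y. y = p \<and> x \<noteq> p}" using p_iff p(1) by metis
    also have "\<dots> = (if \<sigma> x \<noteq> x then {p} else {})" using p_iff [OF that] by (cases "x = p") simp_all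
    finally have "{y \<in> V. \<sigma> y = x \<and> x \<noteq> y} = (if \<sigma> x \<noteq> x then {p} else {})" .
    moreover have "M\<inverse> `` {x} = {y \<in> V. \<sigma> y = x \<and> x \<noteq> y}" by (auto simp: M_def)
    ultimately have "M\<inverse> `` {x} = (if \<sigma> x \<noteq> x then {p} else {})" by simp
    then show ?thesis by (simp add: out_deg_def bij_betw_def)
  qed
  have diff: "out_deg (A - M) x = out_deg A x - of_bool (\<sigma> x \<noteq> x)"
    "in_deg (A - M) x = in_deg A x - of_bool (\<sigma> x \<noteq> x)" if "x \<in> V" for x
  proof -
    show "out_deg (A - M) x = out_deg A x - of_bool (\<sigma> x \<noteq> x)"
      using out_deg_Diff [OF finA MA] out_M [OF that] by simp
    have "(A - M)\<inverse> = A\<inverse> - M\<inverse>" "M\<inverse> \<subseteq> A\<inverse>" using MA by auto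
    then show "in_deg (A - M) x = in_deg A x - of_bool (\<sigma> x \<noteq> x)"
      using out_deg_Diff [of "A\<inverse>" "M\<inverse>" x] finA in_M [OF that] by simp
  qed
  let ?F = "unordered ` M"
  have orient: "orientation (A - M) (E - ?F)"
    using inj img MA by (auto simp: bij_betw_def inj_on_image_set_diff intro: inj_on_subset)
  have "out_deg (A - M) x \<le> d" if "x \<in> V" for x
  proof -
    have "out_deg A x \<le> Suc d" using Suc.prems(5) [OF that] .
    \<comment> \<open>Without loops in \<open>A\<close>, a fixed point can only come from an added
      loop, so its outdegree was below the bound already.\<close>
    moreover have "out_deg A x < Suc d" if "\<sigma> x = x"
      using A [OF \<open>x \<in> V\<close>] Suc.prems(3) [of x] that by simp
    ultimately show ?thesis using diff(1) [OF that] by (cases "\<sigma> x = x") auto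
  qed
  then obtain P where P: "partition_on (E - ?F) P" "finite P" "card P \<le> d"
    "\<forall>F\<in>P. two_regular (edge_subgraph F)"
    using Suc.IH [of "A - M" "E - ?F"] Suc.prems(1,3,4) orient diff by auto
  \<comment> \<open>Parts must be nonempty, so \<open>?F\<close> is inserted only if the permutation
    moves some vertex.\<close>
  show ?case
  proof (cases "M = {}")
    case True
    then show ?thesis using P by (intro exI [of _ P]) auto
  next
    case False
    have "two_regular (edge_subgraph ?F)"
      using two_regular_permutation [OF \<sigma> M_def] inj_on_subset [OF inj MA] .
    moreover have "partition_on E (insert ?F P)"
    proof -
      have "disjnt ?F (\<Union>P)" using partition_onD1 [OF P(1)] by (auto simp: disjnt_def)
      then show ?thesis
        using P(1) False img MA by (subst partition_on_insert) auto
    qed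
    moreover have "card (insert ?F P) \<le> Suc d"
      using P(2,3) card_insert_le_m1 [of "Suc d" P ?F] by simp
    ultimately show ?thesis using P by (intro exI [of _ "insert ?F P"]) auto
  qed
qed

lemma out_deg_plus_in_deg:
  assumes "finite A" "orientation A E" "\<And>x. (x, x) \<notin> A"
  shows "out_deg A x + in_deg A x = card {e \<in> E. x \<in> e}"
proof -
  let ?B = "{a \<in> A. x \<in> unordered a}"
  have "?B = ({x} \<times> A `` {x}) \<union> (A\<inverse> `` {x} \<times> {x})" by auto
  moreover have "({x} \<times> A `` {x}) \<inter> (A\<inverse> `` {x} \<times> {x}) = {}" using assms(3) by auto
  ultimately have "card ?B = out_deg A x + in_deg A x"
    using assms(1) finite_Image [of A "{x}"] finite_Image [of "A\<inverse>" "{x}"]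
    by (simp add: out_deg_def card_Un_disjoint card_cartesian_product)
  moreover have "bij_betw unordered ?B {e \<in> E. x \<in> e}"
    using assms(2) by (auto simp: bij_betw_def intro: inj_on_subset)
  ultimately show ?thesis using bij_betw_same_card [of unordered ?B] by simp
qed

text \<open>Petersen's theorem for even graphs: an orientation with equal in- and outdegrees halves
  the degree bound, and permutations can then be split off.\<close>

theorem even_two_regular_partition:
  assumes "finite V" "E \<subseteq> Pow V" "\<And>e. e \<in> E \<Longrightarrow> card e = 2"
    and "odd_verts E = {}" "\<And>v. v \<in> V \<Longrightarrow> card {e \<in> E. v \<in> e} \<le> 2 * d"
  shows "\<exists>P. partition_on E P \<and> finite P \<and> card P \<le> d \<and>
    (\<forall>F\<in>P. two_regular (edge_subgraph F))"
proof -
  have finE: "finite E" using assms(1,2) finite_subset by blast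
  \<comment> \<open>With \<open>s = t\<close> the two corrections in the trail lemma cancel, so any
    vertex serves, here \<open>undefined\<close>.\<close>
  obtain A where A: "orientation A E" "\<And>x. out_deg A x = in_deg A x"
    using trail_orientation [of E undefined undefined] finE assms(3,4) by auto
  have finA: "finite A" using A(1) finE by (simp add: bij_betw_finite)
  have AE: "{x, y} \<in> E" if "(x, y) \<in> A" for x y
    using imageI [OF that, of unordered] A(1) by (simp add: bij_betw_def)
  have noloop: "(x, x) \<notin> A" for x using AE [of x x] assms(3) [of "{x, x}"] by auto
  have "A \<subseteq> V \<times> V" using AE assms(2) by fastforce
  moreover have "out_deg A v \<le> d" if "v \<in> V" for v
    using out_deg_plus_in_deg [OF finA A(1) noloop, of v] A(2) assms(5) [OF that] by simp
  ultimately show ?thesis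
    using balanced_two_regular_partition [OF assms(1) _ A(1) noloop A(2)] by blast
qed

subsection \<open>Minimal joins in claw-free graphs\<close>

text \<open>The minimality of the join \<open>F\<close> enters as \<open>min\<close>: exchanging
  \<open>F\<close> along an even set \<open>Z\<close> keeps the odd vertices and must not make
  \<open>F\<close> smaller.\<close>

locale claw_free_min_join =
  fixes V :: "'a set" and E F :: "'a set set"
  assumes finite_V: "finite V" and E_sub: "E \<subseteq> Pow V" and card_E: "e \<in> E \<Longrightarrow> card e = 2"
    and claw: "\<lbrakk>{v, x} \<in> E; {v, y} \<in> E; {v, z} \<in> E; x \<noteq> y; x \<noteq> z; y \<noteq> z\<rbrakk>
      \<Longrightarrow> {x, y} \<in> E \<or> {x, z} \<in> E \<or> {y, z} \<in> E"
    and F_sub: "F \<subseteq> E"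
    and min: "\<lbrakk>Z \<subseteq> E; odd_verts Z = {}\<rbrakk> \<Longrightarrow> card (Z \<inter> F) \<le> card (Z - F)"
begin

section \<open>The components of \<open>F\<close> are induced paths\<close>

lemma finite_E: "finite E"
  using E_sub finite_V by (simp add: finite_subset)

lemma finite_F: "finite F"
  using F_sub finite_E by (rule finite_subset)

lemma finite_sub: "Q \<subseteq> F \<Longrightarrow> finite Q"
  using finite_F finite_subset by metis

lemma edge_neq: "{x, y} \<in> E \<Longrightarrow> x \<noteq> y"
  using card_E [of "{x, y}"] by auto

lemma F_edge_neq: "{x, y} \<in> F \<Longrightarrow> x \<noteq> y"
  using edge_neq F_sub by blast

lemma linked_F: "{x, y} \<in> F \<Longrightarrow> linked F x y"
  using linked_edge F_edge_neq by metis

lemma linked_F_trans: "linked F x y \<Longrightarrow> linked F y z \<Longrightarrow> linked F x z"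
  using linked_trans [OF finite_F] .

lemma linkedE:
  assumes "linked F x y" "x \<noteq> y"
  obtains Q where "Q \<subseteq> F" "odd_verts Q = {x, y}"
proof -
  have "sym_diff {x} {y} = {x, y}" using assms(2) by auto
  then show ?thesis using assms(1) that unfolding linked_def by metis
qed

text \<open>An even subset of \<open>F\<close> has no edges outside \<open>F\<close>, so
  \<open>min\<close> leaves it none inside.\<close>

lemma forest: "Q \<subseteq> F \<Longrightarrow> odd_verts Q = {} \<Longrightarrow> Q = {}"
proof -
  assume Q: "Q \<subseteq> F" "odd_verts Q = {}"
  then have "card (Q \<inter> F) \<le> card (Q - F)" using F_sub by (intro min) auto
  moreover have "Q \<inter> F = Q" "Q - F = {}" using Q by auto
  ultimately show "Q = {}" using finite_sub [OF Q(1)] by simp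
qed

text \<open>Paths in a forest are unique: the symmetric difference of the two joins is even.\<close>

lemma join_unique:
  assumes "Q \<subseteq> F" "R \<subseteq> F" "odd_verts Q = odd_verts R"
  shows "Q = R"
proof -
  have "odd_verts (sym_diff Q R) = {}"
    using odd_verts_sym_diff [OF finite_sub finite_sub, OF assms(1,2)] assms(3) by simp
  moreover have "sym_diff Q R \<subseteq> F" using assms(1,2) by auto
  ultimately have "sym_diff Q R = {}" by (intro forest)
  then show ?thesis by auto
qed

text \<open>A single edge is its own boundary; this recovers edges of \<open>F\<close> from short
  joins.\<close>

lemma join_le_1:
  assumes "Q \<subseteq> F" "card Q \<le> 1" "odd_verts Q \<noteq> {}"
  shows "odd_verts Q \<in> F"
proof -
  have "Q \<noteq> {}" using assms(3) by auto
  then have "card Q = 1" using assms(2) finite_sub [OF assms(1)] card_gt_0_iff [of Q] by linarith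
  then obtain e where "Q = {e}" by (rule card_1_singletonE)
  then show ?thesis using assms(1) by simp
qed

text \<open>Otherwise \<open>{x, y}\<close> closes a path of \<open>F\<close> to an even set with
  one edge outside \<open>F\<close>. By \<open>min\<close> the path has only one edge, which would
  have to be \<open>{x, y}\<close> itself.\<close>

lemma non_F_not_linked:
  assumes "{x, y} \<in> E - F"
  shows "\<not> linked F x y"
proof
  assume "linked F x y"
  moreover have neq: "x \<noteq> y" using assms edge_neq by blast
  ultimately obtain Q where Q: "Q \<subseteq> F" "odd_verts Q = {x, y}" by (rule linkedE)
  have new: "{x, y} \<notin> Q" using Q(1) assms by blast
  have "odd_verts (insert {x, y} Q) = {}"
    using odd_verts_insert [OF finite_sub [OF Q(1)] new] Q(2) by simp
  moreover have "insert {x, y} Q \<subseteq> E" using Q(1) F_sub assms by auto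
  ultimately have "card (insert {x, y} Q \<inter> F) \<le> card (insert {x, y} Q - F)" by (intro min)
  moreover have "insert {x, y} Q \<inter> F = Q" "insert {x, y} Q - F = {{x, y}}"
    using Q(1) assms by auto
  ultimately have "card Q \<le> 1" by simp
  then have "{x, y} \<in> F" using join_le_1 [OF Q(1)] Q(2) by simp
  then show False using assms by blast
qed

lemma linked_edge_in_F: "{x, y} \<in> E \<Longrightarrow> linked F x y \<Longrightarrow> {x, y} \<in> F"
  using non_F_not_linked by blast

lemma no_triangle: "\<lbrakk>{a, b} \<in> F; {b, c} \<in> F; {a, c} \<in> F\<rbrakk> \<Longrightarrow> False"
proof -
  assume F: "{a, b} \<in> F" "{b, c} \<in> F" "{a, c} \<in> F"
  then have "a \<noteq> b" "b \<noteq> c" "a \<noteq> c" using F_edge_neq by blast+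
  then have "odd_verts {{a, b}, {b, c}, {a, c}} = {}"
    by (auto simp: odd_verts_insert doubleton_eq_iff)
  then have "{{a, b}, {b, c}, {a, c}} = {}" using F by (intro forest) auto
  then show False by simp
qed

lemma path_ends_not_adjacent:
  assumes "{a, b} \<in> F" "{b, c} \<in> F"
  shows "{a, c} \<notin> E"
proof
  assume "{a, c} \<in> E"
  moreover have "linked F a c" using linked_F_trans linked_F assms by blast
  ultimately have "{a, c} \<in> F" by (rule linked_edge_in_F)
  then show False using no_triangle assms by blast
qed

text \<open>Claw-freeness makes two of the three neighbours adjacent, but they are the ends of a
  path of two edges of \<open>F\<close>.\<close>

lemma F_degree_le_2:
  assumes "{v, x} \<in> F" "{v, y} \<in> F" "{v, z} \<in> F" "x \<noteq> y" "x \<noteq> z" "y \<noteq> z"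
  shows False
proof -
  have "{v, x} \<in> E" "{v, y} \<in> E" "{v, z} \<in> E" using assms(1-3) F_sub by blast+
  then have "{x, y} \<in> E \<or> {x, z} \<in> E \<or> {y, z} \<in> E" using assms(4-6) by (rule claw)
  moreover have "{x, v} \<in> F" "{y, v} \<in> F" using assms(1,2) by (simp_all add: insert_commute)
  ultimately show False using path_ends_not_adjacent assms(2,3) by blast
qed

section \<open>Neighbours of a vertex in one component of \<open>F\<close>\<close>

text \<open>The two edges at \<open>v\<close> complete \<open>Q\<close> to an even set. As they are
  its only edges outside \<open>F\<close>, \<open>min\<close> allows at most two edges in
  \<open>Q\<close>.\<close>

lemma short_join:
  assumes "{v, a} \<in> E - F" "{v, c} \<in> E - F" "a \<noteq> c" "Q \<subseteq> F" "odd_verts Q = {a, c}"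
  shows "card Q \<le> 2"
proof -
  have neq: "v \<noteq> a" "v \<noteq> c" using assms(1,2) edge_neq by blast+
  have new: "{v, c} \<notin> Q" "{v, a} \<notin> insert {v, c} Q"
    using assms neq by (auto simp: doubleton_eq_iff)
  have fin: "finite Q" using finite_sub assms(4) .
  let ?Z = "insert {v, a} (insert {v, c} Q)"
  have "odd_verts ?Z = sym_diff {v, a} (sym_diff {v, c} {a, c})"
    using odd_verts_insert [of "insert {v, c} Q"] odd_verts_insert [OF fin new(1)] fin new(2) assms(5)
    by simp
  also have "\<dots> = {}" using neq assms(3) by auto
  finally have "odd_verts ?Z = {}" .
  moreover have "?Z \<subseteq> E" using assms(1,2,4) F_sub by auto
  ultimately have "card (?Z \<inter> F) \<le> card (?Z - F)" by (intro min)
  moreover have "?Z \<inter> F = Q" "?Z - F = {{v, a}, {v, c}}" using assms(1,2,4) by auto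
  ultimately show ?thesis using card_insert_le_m1 [of 2 "{{v, c}}" "{v, a}"] by simp
qed

text \<open>The join of \<open>a\<close> and \<open>c\<close> has at most two edges; removing one at
  \<open>a\<close>, say \<open>{a, b}\<close>, leaves nothing or the edge
  \<open>{b, c}\<close>.\<close>

lemma linked_neighbours_cases:
  assumes "{v, a} \<in> E - F" "{v, c} \<in> E - F" "a \<noteq> c" "linked F a c"
  obtains "{a, c} \<in> F" | b where "{a, b} \<in> F" "{b, c} \<in> F"
proof -
  obtain Q where Q: "Q \<subseteq> F" "odd_verts Q = {a, c}" using linkedE [OF assms(4,3)] .
  have fin: "finite Q" using finite_sub Q(1) .
  have "a \<in> \<Union>Q" using odd_verts_subset [of Q] Q(2) by blast
  then obtain e where e: "e \<in> Q" "a \<in> e" by blast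
  have "card e = 2" using e(1) Q(1) F_sub card_E by blast
  then obtain b where b: "e = {a, b}" "b \<noteq> a" using other_endpoint e(2) by metis
  have ab: "{a, b} \<in> F" using b(1) e(1) Q(1) by blast
  show ?thesis
  proof (cases "b = c")
    case True
    then show ?thesis using that(1) ab by simp
  next
    case False
    have "odd_verts (Q - {e}) = sym_diff {a, b} {a, c}"
      using odd_verts_remove [OF fin e(1)] Q(2) b(1) by simp
    also have "\<dots> = {b, c}" using False b(2) assms(3) by auto
    finally have odd: "odd_verts (Q - {e}) = {b, c}" .
    have "card (Q - {e}) \<le> 1" using short_join [OF assms(1-3) Q] e(1) by simp
    then have "odd_verts (Q - {e}) \<in> F" using Q(1) odd by (intro join_le_1) auto
    then show ?thesis using that(2) ab odd by simp
  qed
qed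

text \<open>Otherwise let \<open>P\<close> and \<open>P'\<close> join \<open>a\<close> and
  \<open>c\<close> to \<open>y\<close> by at most two edges each. If \<open>{b, c}\<close> were in
  \<open>P'\<close>, then \<open>{b, y}\<close> would be a third edge of \<open>F\<close> at
  \<open>b\<close>. By uniqueness of joins \<open>P\<close> and \<open>P'\<close> differ in
  \<open>{a, b}\<close> and \<open>{b, c}\<close>, so \<open>{b, c}\<close> lies in
  \<open>P\<close>, too far from both ends.\<close>

lemma linked_neighbour_midpoint:
  assumes v: "{v, a} \<in> E - F" "{v, c} \<in> E - F" "{v, y} \<in> E - F"
    and F: "{a, b} \<in> F" "{b, c} \<in> F" and neq: "a \<noteq> c" "y \<noteq> a" "y \<noteq> c" and "linked F a y"
  shows "y = b"
proof (rule ccontr)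
  assume "y \<noteq> b"
  have ab: "a \<noteq> b" "b \<noteq> c" using F F_edge_neq by blast+
  have "linked F c y"
    using linked_F_trans [OF linked_F_trans] linked_sym [OF linked_F [OF F(1)]]
      linked_sym [OF linked_F [OF F(2)]] assms(9) by blast
  then obtain P' where P': "P' \<subseteq> F" "odd_verts P' = {c, y}" using neq linkedE by metis
  obtain P where P: "P \<subseteq> F" "odd_verts P = {a, y}" using assms(9) neq linkedE by metis
  have fin: "finite P" "finite P'" using finite_sub P(1) P'(1) by blast+
  have le: "card P \<le> 2" "card P' \<le> 2"
    using short_join [OF v(1,3) _ P] short_join [OF v(2,3) _ P'] neq by simp_all
  have by_F: "{b, y} \<notin> F"
  proof
    assume "{b, y} \<in> F"
    moreover have "{b, a} \<in> F" using F(1) by (simp add: insert_commute)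
    ultimately show False using F_degree_le_2 [of b a c y] F(2) neq by simp
  qed
  have ab_P: "{a, b} \<notin> P"
  proof
    assume e: "{a, b} \<in> P"
    have "odd_verts (P - {{a, b}}) = sym_diff {a, b} {a, y}"
      using odd_verts_remove [OF fin(1) e] P(2) by simp
    also have "\<dots> = {b, y}" using ab neq \<open>y \<noteq> b\<close> by auto
    finally have "odd_verts (P - {{a, b}}) = {b, y}" .
    moreover have "card (P - {{a, b}}) \<le> 1" using le(1) e by simp
    ultimately have "{b, y} \<in> F" using join_le_1 [of "P - {{a, b}}"] P(1) by auto
    then show False using by_F by simp
  qed
  have bc_P': "{b, c} \<notin> P'"
  proof
    assume e: "{b, c} \<in> P'"
    have "odd_verts (P' - {{b, c}}) = sym_diff {b, c} {c, y}"
      using odd_verts_remove [OF fin(2) e] P'(2) by simp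
    also have "\<dots> = {b, y}" using ab neq \<open>y \<noteq> b\<close> by auto
    finally have "odd_verts (P' - {{b, c}}) = {b, y}" .
    moreover have "card (P' - {{b, c}}) \<le> 1" using le(2) e by simp
    ultimately have "{b, y} \<in> F" using join_le_1 [of "P' - {{b, c}}"] P'(1) by auto
    then show False using by_F by simp
  qed
  have "odd_verts (sym_diff P P') = sym_diff {a, y} {c, y}"
    using odd_verts_sym_diff [OF fin] P(2) P'(2) by simp
  also have "\<dots> = {a, c}" using neq by auto
  also have "\<dots> = odd_verts {{a, b}, {b, c}}"
    using ab neq by (auto simp: odd_verts_insert doubleton_eq_iff)
  finally have "sym_diff P P' = {{a, b}, {b, c}}"
    using P(1) P'(1) F by (intro join_unique) auto
  then have bc_P: "{b, c} \<in> P" using bc_P' by auto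
  have "odd_verts (P - {{b, c}}) = sym_diff {b, c} {a, y}"
    using odd_verts_remove [OF fin(1) bc_P] P(2) by simp
  also have "\<dots> = {a, b, c, y}" using ab neq \<open>y \<noteq> b\<close> by auto
  finally have odd: "odd_verts (P - {{b, c}}) = {a, b, c, y}" .
  have "card (P - {{b, c}}) \<le> 1" using le(1) bc_P by simp
  \<comment> \<open>What remains of \<open>P\<close> is at most one edge, yet it has four odd
    vertices.\<close>
  then have "{a, b, c, y} \<in> F" using join_le_1 [of "P - {{b, c}}"] P(1) odd by auto
  then have "card {a, b, c, y} = 2" using F_sub card_E by blast
  then show False using ab neq \<open>y \<noteq> b\<close> by simp
qed

text \<open>As \<open>F\<close> has no triangle, some two elements \<open>p\<close> and
  \<open>q\<close> of \<open>C\<close> are not joined by an edge of \<open>F\<close>. They have a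
  common neighbour \<open>b\<close> in \<open>F\<close>, and every further element of
  \<open>C\<close> equals \<open>b\<close>.\<close>

lemma linked_neighbours_path:
  assumes C: "\<And>x. x \<in> C \<Longrightarrow> {v, x} \<in> E - F" "\<And>x y. x \<in> C \<Longrightarrow> y \<in> C \<Longrightarrow> linked F x y"
    and "3 \<le> card C"
  obtains a b c where "C = {a, b, c}" "a \<noteq> c" "{a, b} \<in> F" "{b, c} \<in> F"
proof -
  obtain T where T: "T \<subseteq> C" "card T = 3"
    using obtain_subset_with_card_n [OF assms(3)] by metis
  then obtain x y z where "T = {x, y, z}" and xyz: "x \<noteq> y" "x \<noteq> z" "y \<noteq> z"
    by (auto simp: card_3_iff)
  then have inC: "x \<in> C" "y \<in> C" "z \<in> C" using T(1) by auto
  have "\<exists>p q. p \<in> C \<and> q \<in> C \<and> p \<noteq> q \<and> {p, q} \<notin> F"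
    using no_triangle [of x y z] xyz inC by blast
  then obtain p q where pq: "p \<in> C" "q \<in> C" "p \<noteq> q" "{p, q} \<notin> F" by blast
  obtain b where b: "{p, b} \<in> F" "{b, q} \<in> F"
    using linked_neighbours_cases [OF C(1) C(1) pq(3) C(2)] pq by metis
  have "C \<subseteq> {p, b, q}"
  proof
    fix y assume y: "y \<in> C"
    show "y \<in> {p, b, q}"
      using linked_neighbour_midpoint [OF C(1) C(1) C(1) b pq(3), of y] C(2) [OF pq(1) y] pq(1,2) y
      by blast
  qed
  moreover have "card {p, b, q} \<le> card C"
    using assms(3) card_insert_le_m1 [of 3 "{b, q}" p] card_insert_le_m1 [of 2 "{q}" b] by simp
  ultimately have "C = {p, b, q}" by (intro card_seteq) auto
  then show ?thesis using that pq(3) b by blast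
qed

section \<open>Neighbours in several components, and the bound on \<open>F\<close>\<close>

text \<open>The two paths and the two edges between their ends form a 6-cycle. Separation keeps its
  vertices distinct and puts the two connecting edges outside \<open>F\<close>, so four of six edges
  lie in \<open>F\<close>, against \<open>min\<close>.\<close>

lemma no_hexagon:
  assumes "{a, b} \<in> F" "{b, c} \<in> F" "{a', b'} \<in> F" "{b', c'} \<in> F" "a \<noteq> c" "a' \<noteq> c'"
    and sep: "\<not> linked F a a'" and E: "{a, a'} \<in> E" "{c, c'} \<in> E"
  shows False
proof -
  have ab: "a \<noteq> b" "b \<noteq> c" "a' \<noteq> b'" "b' \<noteq> c'" using assms(1-4) F_edge_neq by blast+
  have l: "linked F a b" "linked F a c" "linked F a' b'" "linked F a' c'"
    using linked_F_trans linked_F assms(1-4) by blast+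
  have sep': "\<not> linked F x y" if "linked F a x" "linked F a' y" for x y
    using linked_F_trans [OF linked_F_trans [OF that(1)] linked_sym [OF that(2)]] sep by blast
  have neq: "x \<noteq> y" if "linked F a x" "linked F a' y" for x y
    using sep' [OF that] linked_refl [of F x] by blast
  have cross: "a \<noteq> a'" "a \<noteq> b'" "a \<noteq> c'" "b \<noteq> a'" "b \<noteq> b'" "b \<noteq> c'" "c \<noteq> a'" "c \<noteq> b'" "c \<noteq> c'"
    using neq l linked_refl by metis+
  have notF: "{a, a'} \<notin> F" "{c, c'} \<notin> F"
    using sep' [OF linked_refl linked_refl] sep' [OF l(2,4)] linked_F by blast+
  let ?X = "{{a, b}, {b, c}, {a', b'}, {b', c'}}" and ?Y = "{{a, a'}, {c, c'}}"
  have "odd_verts (?X \<union> ?Y) = {}"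
    using ab assms(5,6) cross by (auto simp: odd_verts_insert doubleton_eq_iff)
  moreover have "?X \<union> ?Y \<subseteq> E" using assms(1-4) F_sub E by auto
  ultimately have "card ((?X \<union> ?Y) \<inter> F) \<le> card ((?X \<union> ?Y) - F)" by (intro min)
  moreover have "(?X \<union> ?Y) \<inter> F = ?X" "(?X \<union> ?Y) - F = ?Y" using assms(1-4) notF by auto
  moreover have "card ?X = 4" using ab assms(5,6) cross by (simp add: doubleton_eq_iff)
  moreover have "card ?Y = 2" using cross assms(5) by (simp add: doubleton_eq_iff)
  ultimately show False by simp
qed

text \<open>The ends of each path are not adjacent. So claw-freeness at \<open>v\<close>, applied to
  each three of the four ends, gives every end a neighbour among the ends of the other path. Hence
  the four ends contain a perfect matching between the paths, which closes a hexagon.\<close>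

lemma no_two_paths:
  assumes v: "{v, a} \<in> E" "{v, c} \<in> E" "{v, a'} \<in> E" "{v, c'} \<in> E"
    and F: "{a, b} \<in> F" "{b, c} \<in> F" "{a', b'} \<in> F" "{b', c'} \<in> F" and neq: "a \<noteq> c" "a' \<noteq> c'"
    and sep: "\<not> linked F a a'"
  shows False
proof -
  have l: "linked F a c" "linked F a' c'" using linked_F_trans linked_F F by blast+
  have sep': "\<not> linked F x y" if "linked F a x" "linked F a' y" for x y
    using linked_F_trans [OF linked_F_trans [OF that(1)] linked_sym [OF that(2)]] sep by blast
  have neq': "x \<noteq> y" if "linked F a x" "linked F a' y" for x y
    using sep' [OF that] linked_refl [of F x] by blast
  have cross: "a \<noteq> a'" "a \<noteq> c'" "c \<noteq> a'" "c \<noteq> c'"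
    using neq' l linked_refl by metis+
  have ends: "{a, c} \<notin> E" "{a', c'} \<notin> E" using path_ends_not_adjacent F by blast+
  have F': "{c', b'} \<in> F" "{b', a'} \<in> F" using F by (simp_all add: insert_commute)
  have "{a, a'} \<in> E \<or> {c, a'} \<in> E" using claw [OF v(1,2,3)] neq cross ends by blast
  moreover have "{a, c'} \<in> E \<or> {c, c'} \<in> E" using claw [OF v(1,2,4)] neq cross ends by blast
  moreover have "{a, a'} \<in> E \<or> {a, c'} \<in> E" using claw [OF v(1,3,4)] neq cross ends by blast
  moreover have "{c, a'} \<in> E \<or> {c, c'} \<in> E" using claw [OF v(2,3,4)] neq cross ends by blast
  moreover have "\<not> ({a, a'} \<in> E \<and> {c, c'} \<in> E)"
    using no_hexagon [OF F neq sep] by blast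
  \<comment> \<open>The other matching is treated by reversing the second path.\<close>
  moreover have "\<not> ({a, c'} \<in> E \<and> {c, a'} \<in> E)"
    using no_hexagon [OF F(1,2) F' neq(1) neq(2) [symmetric] sep' [OF linked_refl l(2)]] by blast
  ultimately show False by blast
qed

text \<open>The neighbours \<open>W\<close> of \<open>v\<close> along \<open>E - F\<close> are
  grouped into classes \<open>K\<close> by the components of \<open>F\<close>. Their sizes give
  \<open>card W \<le> 2 * card K + 1\<close>, and representatives of the classes together with
  \<open>v\<close> give \<open>card F + card K + 1 \<le> card V\<close>.\<close>

lemma join_bound:
  assumes "v \<in> V"
  shows "2 * card F + card {w. {v, w} \<in> E - F} < 2 * card V"
proof -
  define W where "W = {w. {v, w} \<in> E - F}"
  define r where "r = {(x, y) \<in> W \<times> W. linked F x y}"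
  define K where "K = W // r"
  have WV: "W \<subseteq> V" using E_sub by (auto simp: W_def)
  have finW: "finite W" using WV finite_V by (rule finite_subset)
  have equiv: "equiv W r"
  proof (rule equivI)
    show "r \<subseteq> W \<times> W" by (auto simp: r_def)
    show "refl_on W r" by (auto simp: refl_on_def r_def linked_refl)
    show "sym r" by (auto simp: sym_def r_def intro: linked_sym)
    show "trans r" by (auto simp: trans_def r_def intro: linked_F_trans)
  qed
  have finK: "finite K" using finW equiv by (simp add: K_def finite_quotient equiv_type)
  have K_sub: "C \<subseteq> W" if "C \<in> K" for C
    using that equiv by (auto simp: K_def in_quotient_imp_subset)
  have K_linked: "linked F x y" if "C \<in> K" "x \<in> C" "y \<in> C" for C x y
    using in_quotient_imp_in_rel [OF equiv, of C x y] that by (simp add: K_def r_def)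
  have K_eq: "C = D" if "C \<in> K" "D \<in> K" "x \<in> C" "y \<in> D" "linked F x y" for C D x y
  proof -
    have "(x, y) \<in> r" using that K_sub by (auto simp: r_def)
    then show ?thesis using quotient_eqI [OF equiv, of C D x y] that by (simp add: K_def)
  qed
  have K_ne: "C \<noteq> {}" if "C \<in> K" for C
    using in_quotient_imp_non_empty [OF equiv] that by (simp add: K_def)
  have W_sum: "card W = (\<Sum>C\<in>K. card C)"
  proof -
    have "W = \<Union>K" using Union_quotient [OF equiv] by (simp add: K_def)
    moreover have "card (\<Union>K) = (\<Sum>C\<in>K. card C)"
    proof (rule card_Union_disjoint)
      show "pairwise disjnt K"
        using quotient_disj [OF equiv] by (auto simp: pairwise_def disjnt_def K_def)
      show "finite C" if "C \<in> K" for C using K_sub [OF that] finW by (rule finite_subset)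
    qed
    ultimately show ?thesis by simp
  qed
  have path: "\<exists>a b c. C = {a, b, c} \<and> a \<noteq> c \<and> {a, b} \<in> F \<and> {b, c} \<in> F"
    if C: "C \<in> K" "3 \<le> card C" for C
  proof -
    have "{v, x} \<in> E - F" if "x \<in> C" for x using K_sub [OF C(1)] that by (auto simp: W_def)
    then show ?thesis
      using linked_neighbours_path [of C v] K_linked [OF C(1)] C(2) by metis
  qed
  have big_unique: "C = D" if CD: "C \<in> K" "D \<in> K" "3 \<le> card C" "3 \<le> card D" for C D
  proof (rule ccontr)
    assume "C \<noteq> D"
    obtain a b c where C: "C = {a, b, c}" "a \<noteq> c" "{a, b} \<in> F" "{b, c} \<in> F"
      using path [OF CD(1,3)] by blast
    obtain a' b' c' where D: "D = {a', b', c'}" "a' \<noteq> c'" "{a', b'} \<in> F" "{b', c'} \<in> F"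
      using path [OF CD(2,4)] by blast
    have "{v, a} \<in> E" "{v, c} \<in> E" "{v, a'} \<in> E" "{v, c'} \<in> E"
      using K_sub [OF CD(1)] K_sub [OF CD(2)] C(1) D(1) by (auto simp: W_def)
    moreover have "\<not> linked F a a'" using K_eq [OF CD(1,2), of a a'] C(1) D(1) \<open>C \<noteq> D\<close> by auto
    ultimately show False using no_two_paths C(2-) D(2-) by metis
  qed
  \<comment> \<open>The extra 1 pays for the only possible class of size three.\<close>
  have "card W \<le> 2 * card K + 1"
  proof (cases "\<exists>B\<in>K. 3 \<le> card B")
    case True
    then obtain B where B: "B \<in> K" "3 \<le> card B" by blast
    obtain a b c where "B = {a, b, c}" using path [OF B] by blast
    then have "card B \<le> 3"
      using card_insert_le_m1 [of 3 "{b, c}" a] card_insert_le_m1 [of 2 "{c}" b] by simp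
    moreover have "(\<Sum>C\<in>K - {B}. card C) \<le> (\<Sum>C\<in>K - {B}. 2)"
    proof (rule sum_mono)
      fix C assume "C \<in> K - {B}"
      then have "\<not> 3 \<le> card C" using big_unique [of C B] B by blast
      then show "card C \<le> 2" by simp
    qed
    moreover have "card W = card B + (\<Sum>C\<in>K - {B}. card C)"
      using W_sum finK B(1) by (simp add: sum.remove)
    moreover have "card K > 0" using finK B(1) card_gt_0_iff by blast
    ultimately show ?thesis using finK B(1) by simp
  next
    case False
    then have "(\<Sum>C\<in>K. card C) \<le> (\<Sum>C\<in>K. 2)" by (intro sum_mono) fastforce
    then show ?thesis using W_sum by simp
  qed
  obtain f where f: "\<forall>C\<in>K. f C \<in> C" using K_ne bchoice [of K "\<lambda>C x. x \<in> C"] by auto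
  have fW: "f C \<in> W" if "C \<in> K" for C using f K_sub that by blast
  have "inj_on f K"
  proof (rule inj_onI)
    fix C D assume CD: "C \<in> K" "D \<in> K" "f C = f D"
    show "C = D"
      using K_eq [OF CD(1,2) bspec [OF f CD(1)] bspec [OF f CD(2)]] CD(3)
      by (simp add: linked_refl)
  qed
  \<comment> \<open>So \<open>v\<close> lies in a component of its own and counts as one more
    representative.\<close>
  moreover have v_f: "\<not> linked F v (f C)" if "C \<in> K" for C
    using non_F_not_linked fW [OF that] by (simp add: W_def)
  moreover have "v \<notin> f ` K"
  proof
    assume "v \<in> f ` K"
    then obtain C where "v = f C" "C \<in> K" by (rule imageE)
    then show False using v_f [of C] by (simp add: linked_refl)
  qed
  ultimately have "card (insert v (f ` K)) = Suc (card K)" using finK by (simp add: card_image)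
  moreover have "card F + card (insert v (f ` K)) \<le> card V"
  proof (rule card_forest_le [OF finite_V])
    show "F \<subseteq> Pow V" using F_sub E_sub by blast
    show "card e = 2" if "e \<in> F" for e using that F_sub card_E by blast
    show "Q = {}" if "Q \<subseteq> F" "odd_verts Q = {}" for Q using forest that .
    show "insert v (f ` K) \<subseteq> V" using assms fW WV by blast
    show "x = y" if "x \<in> insert v (f ` K)" "y \<in> insert v (f ` K)" "linked F x y" for x y
    proof -
      have f_v: "\<not> linked F (f C) v" if "C \<in> K" for C
        using v_f [OF that] linked_sym [of F "f C" v] by blast
      have f_f: "f C = f D" if "C \<in> K" "D \<in> K" "linked F (f C) (f D)" for C D
        using K_eq [OF that(1,2) _ _ that(3)] f that(1,2) by blast
      show ?thesis
        using that by (elim insertE imageE) (use v_f f_v f_f in simp_all)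
    qed
  qed
  ultimately have "card F + card K + 1 \<le> card V" by simp
  with \<open>card W \<le> 2 * card K + 1\<close> show ?thesis unfolding W_def by linarith
qed

end

section \<open>Choice of the join and assembly of the decomposition\<close>

text \<open>\<open>F\<close> is a smallest subset of \<open>E\<close> with the odd vertices of
  \<open>E\<close>. For even \<open>Z\<close>, \<open>sym_diff F Z\<close> is a competitor, and
  cancelling \<open>F - Z\<close> in the comparison of sizes gives the exchange property.\<close>

lemma min_join_exists:
  assumes "finite E"
  obtains F where "F \<subseteq> E" "odd_verts (E - F) = {}"
    "\<And>Z. Z \<subseteq> E \<Longrightarrow> odd_verts Z = {} \<Longrightarrow> card (Z \<inter> F) \<le> card (Z - F)"
proof -
  have "\<exists>F. (F \<subseteq> E \<and> odd_verts F = odd_verts E) \<and>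
      (\<forall>F'. F' \<subseteq> E \<and> odd_verts F' = odd_verts E \<longrightarrow> card F \<le> card F')"
    by (rule ex_has_least_nat [of _ E]) simp
  then obtain F where F: "F \<subseteq> E" "odd_verts F = odd_verts E"
    and min: "\<And>F'. F' \<subseteq> E \<Longrightarrow> odd_verts F' = odd_verts E \<Longrightarrow> card F \<le> card F'"
    by (elim exE conjE) simp
  have finF: "finite F" using F(1) assms by (rule finite_subset)
  have "E - F = sym_diff E F" using F(1) by auto
  then have "odd_verts (E - F) = {}" using odd_verts_sym_diff [OF assms finF] F(2) by simp
  moreover have "card (Z \<inter> F) \<le> card (Z - F)" if Z: "Z \<subseteq> E" "odd_verts Z = {}" for Z
  proof -
    have finZ: "finite Z" using Z(1) assms by (rule finite_subset)
    have "card F \<le> card (sym_diff F Z)"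
      using odd_verts_sym_diff [OF finF finZ] F Z by (intro min) auto
    moreover have "card (sym_diff F Z) = card (F - Z) + card (Z - F)"
      using finF finZ by (intro card_Un_disjoint) auto
    moreover have "card F = card (F - Z) + card (Z \<inter> F)"
      using finF by (subst card_Un_disjoint [symmetric]) (auto intro: arg_cong [where f = card])
    ultimately show ?thesis by linarith
  qed
  ultimately show ?thesis using that F(1) by blast
qed

lemma claw_freeD:
  assumes G: "simple_graph G" "claw_free G"
    and E: "{v, x} \<in> edges G" "{v, y} \<in> edges G" "{v, z} \<in> edges G" and neq: "x \<noteq> y" "x \<noteq> z" "y \<noteq> z"
  shows "{x, y} \<in> edges G \<or> {x, z} \<in> edges G \<or> {y, z} \<in> edges G"
proof (rule ccontr)
  assume no: "\<not> ?thesis"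
  have loop: "{u} \<notin> edges G" for u using G(1) by (auto simp: simple_graph_def)
  have v: "v \<noteq> x" "v \<noteq> y" "v \<noteq> z" using E loop by auto
  \<comment> \<open>The centre goes to 0 and the leaves to 1, 2, 3; among the four vertices the last
    case is \<open>z\<close>.\<close>
  define f :: "'a \<Rightarrow> nat" where
    "f u = (if u = v then 0 else if u = x then 1 else if u = y then 2 else 3)" for u
  have f: "f v = 0" "f x = 1" "f y = 2" "f z = 3" using v neq by (auto simp: f_def)
  have "bij_betw f {v, x, y, z} {0, 1, 2, 3}" using f by (auto simp: bij_betw_def)
  moreover have "\<forall>u\<in>{v, x, y, z}. \<forall>w\<in>{v, x, y, z}.
      {u, w} \<in> edges (induced_subgraph G {v, x, y, z}) \<longleftrightarrow> {f u, f w} \<in> edges claw"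
    using E no loop v neq
    by (simp add: induced_subgraph_def claw_def f doubleton_eq_iff insert_commute)
  ultimately have "isomorphic (induced_subgraph G {v, x, y, z}) claw"
    unfolding isomorphic_def by (intro exI [of _ f]) (simp add: induced_subgraph_def claw_def)
  moreover have "{v, x, y, z} \<subseteq> verts G" using E G(1) by (auto simp: simple_graph_def)
  ultimately show False using G(2) unfolding claw_free_def by blast
qed

theorem theorem1p6:
  fixes G :: "'a ugraph" and n :: nat
  assumes "simple_graph G"
    and "card (verts G) = n"
    and "claw_free G"
  shows "f_re G \<le> n - 1 \<and>
    (\<exists>P. partition_on (edges G) P \<and> card P \<le> n - 1 \<and>
      (\<forall>F\<in>P. (\<exists>H. subgraph H G \<and> two_regular H \<and> edges H = F) \<or> (\<exists>e. F = {e})))"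
proof -
  let ?V = "verts G" and ?E = "edges G"
  have G: "finite ?V" "?V \<noteq> {}" "?E \<subseteq> Pow ?V" "\<And>e. e \<in> ?E \<Longrightarrow> card e = 2"
    using assms(1) by (auto simp: simple_graph_def)
  obtain F where F: "F \<subseteq> ?E" "odd_verts (?E - F) = {}"
    and min: "\<And>Z. Z \<subseteq> ?E \<Longrightarrow> odd_verts Z = {} \<Longrightarrow> card (Z \<inter> F) \<le> card (Z - F)"
    using min_join_exists [OF finite_edges [OF assms(1)]] by metis
  interpret claw_free_min_join ?V ?E F
    using G claw_freeD [OF assms(1,3)] F(1) min by unfold_locales
  let ?deg = "\<lambda>v. card {e \<in> ?E - F. v \<in> e}"
  \<comment> \<open>The bound on \<open>F\<close> is applied at a vertex of maximum degree in
    \<open>E - F\<close>.\<close>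
  define \<Delta> where "\<Delta> = Max (?deg ` ?V)"
  have "\<Delta> \<in> ?deg ` ?V" unfolding \<Delta>_def using G(1,2) by (intro Max_in) auto
  then obtain v where v: "v \<in> ?V" "\<Delta> = ?deg v" by (rule imageE)
  have "bij_betw (\<lambda>w. {v, w}) {w. {v, w} \<in> ?E - F} {e \<in> ?E - F. v \<in> e}"
    unfolding bij_betw_def
  proof
    show "inj_on (\<lambda>w. {v, w}) {w. {v, w} \<in> ?E - F}" by (auto simp: inj_on_def doubleton_eq_iff)
    show "(\<lambda>w. {v, w}) ` {w. {v, w} \<in> ?E - F} = {e \<in> ?E - F. v \<in> e}"
    proof (intro equalityI subsetI)
      fix e assume e: "e \<in> {e \<in> ?E - F. v \<in> e}"
      then obtain w where "e = {v, w}" using other_endpoint [of e v] G(4) by blast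
      then show "e \<in> (\<lambda>w. {v, w}) ` {w. {v, w} \<in> ?E - F}" using e by blast
    qed auto
  qed
  then have "card {w. {v, w} \<in> ?E - F} = \<Delta>" unfolding v(2) by (rule bij_betw_same_card)
  then have bound: "2 * card F + \<Delta> < 2 * n" using join_bound [OF v(1)] assms(2) by simp
  \<comment> \<open>Parity lets the strict inequality be halved to
    \<open>card F + \<Delta> div 2 \<le> n - 1\<close>.\<close>
  have "even \<Delta>" using F(2) unfolding v(2) odd_verts_def by blast
  then have half: "2 * (\<Delta> div 2) = \<Delta>" by simp
  have "?deg u \<le> 2 * (\<Delta> div 2)" if "u \<in> ?V" for u
    unfolding half unfolding \<Delta>_def using that G(1) by (intro Max_ge) auto
  then obtain P where P: "partition_on (?E - F) P" "finite P" "card P \<le> \<Delta> div 2"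
    "\<forall>Q\<in>P. two_regular (edge_subgraph Q)"
    using even_two_regular_partition [of ?V "?E - F" "\<Delta> div 2"] G F(2) by auto
  let ?P = "(\<lambda>e. {e}) ` F \<union> P"
  have part: "partition_on ?E ?P"
  proof -
    note single = partition_on_singletons [of F]
    have disj: "disjnt p q" if "p \<in> (\<lambda>e. {e}) ` F" "q \<in> P" for p q
      using that partition_onD1 [OF P(1)] by (auto simp: disjnt_def)
    show ?thesis
    proof (rule partition_onI)
      show "\<Union>?P = ?E" using partition_onD1 [OF P(1)] F(1) by auto
      show "{} \<notin> ?P" using partition_onD3 [OF P(1)] by auto
      show "disjnt p q" if "p \<in> ?P" "q \<in> ?P" "p \<noteq> q" for p q
        using that(1,2)
      proof (elim UnE)
        assume "p \<in> (\<lambda>e. {e}) ` F" "q \<in> (\<lambda>e. {e}) ` F"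
        then show ?thesis by (rule pairwiseD [OF partition_onD2 [OF single] _ _ that(3)])
      next
        assume "p \<in> P" "q \<in> P"
        then show ?thesis by (rule pairwiseD [OF partition_onD2 [OF P(1)] _ _ that(3)])
      qed (use disj disjnt_sym in metis)+
    qed
  qed
  have "card ?P \<le> card F + card P"
    using card_Un_le [of "(\<lambda>e. {e}) ` F" P] card_image_le [OF finite_F, of "\<lambda>e. {e}"] by linarith
  then have card: "card ?P \<le> n - 1" using P(3) bound half by linarith
  have "re_decomposition G ?P" using part P(4) by (auto simp: re_decomposition_def)
  then have "f_re G \<le> card ?P" unfolding f_re_def by (intro Least_le exI [of _ ?P]) simp
  moreover have "(\<exists>H. subgraph H G \<and> two_regular H \<and> edges H = Q) \<or> (\<exists>e. Q = {e})"
    if Q: "Q \<in> ?P" for Q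
  proof (cases "Q \<in> P")
    case True
    \<comment> \<open>A subgraph needs a nonempty vertex set, which an edge of \<open>Q\<close>
      provides.\<close>
    have "Q \<subseteq> ?E" "Q \<noteq> {}" using part Q by (auto simp: partition_on_def)
    moreover from this obtain e where "e \<in> Q" by blast
    moreover have "card e = 2" using calculation G(4) by blast
    then have "e \<noteq> {}" by auto
    ultimately have "subgraph (edge_subgraph Q) G"
      using G finite_subset [of "\<Union>Q" ?V]
      by (auto simp: subgraph_def simple_graph_def edge_subgraph_def)
    moreover have "edges (edge_subgraph Q) = Q" by (simp add: edge_subgraph_def)
    ultimately show ?thesis using P(4) True by blast
  next
    case False
    then show ?thesis using Q by blast
  qed
  ultimately show ?thesis using part card by (meson order_trans)
qed

end
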